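(* Let $\{x_{n,m}\}_{n\in\mathbb{N}^*,\,1\le m\le n}\subset\mathbb{C}$. The following statements are equivalent: (i) $\{x_{n,m}\}$ satisfies the Catalan's triangle system $$x_{n+1,k+1}=\sum_{j=k}^{n}x_{n,j}\qquad\text{for all } n\in\mathbb{N}^* \text{ and } k\in\{1,\ldots,n\};$$ (ii) $\{x_{n,m}\}$ is determined by $\{x_{n,1}\}_{n\in\mathbb{N}^*}$ through the formula $$x_{n,m}=\sum_{h=0}^{n-m}C_{m-1}(h,h+m-2)\,x_{n-m-h+1,1}\qquad\text{for all } n\ge 2 \text{ and } 2\le m\le n,$$ where $C_{m}(n,k)$ denotes the Catalan's trapezoid of order $m$.
   Context: $\mathbb{N}=\{0,1,2,\ldots\}$, $\mathbb{N}^*=\{1,2,\ldots\}$. For $m\in\mathbb{N}^*$, the Catalan's trapezoid of order $m$ is the family $\{C_m(n,k)\}_{n\in\mathbb{N},\,0\le k\le n+m-1}$ given by $C_m(n,k)=\binom{n+k}{k}$ if $0\le k\le m-1$ and $C_m(n,k)=\binom{n+k}{k}-\binom{n+k}{k-m}$ if $m\le k\le n+m-1$; by convention $C_m(n,k)=0$ if $k>n+m-1$. (Combinatorially, $C_m(n,k)$ counts strings of $n$ X's and $k$ Y's in which, in every initial segment, the number of Y's does not exceed the number of X's by more than $m$... i.e. by $m$ or more is forbidden.) *)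

theory Defs
  imports Complex_Main
begin

text \<open>
  Catalan's trapezoid of order \<open>m \<ge> 1\<close>. Both guards are the strict forms of
  \<open>k \<le> m - 1\<close> and \<open>k \<le> n + m - 1\<close>; the value at \<open>m = 0\<close> has no meaning.
  The values are integers so that the difference of binomials is not truncated.
\<close>

definition catalan_trapezoid :: "nat \<Rightarrow> nat \<Rightarrow> nat \<Rightarrow> int" where
  "catalan_trapezoid m n k =
     (if k < m then int ((n + k) choose k)
      else if k < n + m then int ((n + k) choose k) - int ((n + k) choose (k - m))
      else 0)"

text \<open>
  A family indexed by \<open>1 \<le> m \<le> n\<close> is represented by a total function
  \<open>x n m\<close>; only its values at such indices are constrained.
\<close>

definition catalan_triangle_system :: "(nat \<Rightarrow> nat \<Rightarrow> complex) \<Rightarrow> bool" where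
  "catalan_triangle_system x \<longleftrightarrow>
     (\<forall>n\<ge>1. \<forall>k\<in>{1..n}. x (n + 1) (k + 1) = (\<Sum>j=k..n. x n j))"

end

theory Submission imports Defs begin

text \<open>
  The numbers \<open>C\<^sub>p(h, h + p - 1)\<close> are the coefficients of \<open>c(t)\<^sup>p\<close>, where \<open>c\<close> is the
  generating function of the Catalan numbers. Multiplying \<open>c = 1 + t c\<^sup>2\<close> by \<open>c\<^sup>p\<close> gives a
  two-term recurrence for them, which turns the convolution in (ii) into the local form
  \<open>x\<^bsub>n+1,k+1\<^esub> = x\<^bsub>n,k\<^esub> + x\<^bsub>n+1,k+2\<^esub>\<close> of the Catalan triangle system. So the right-hand
  side of (ii) solves the system for any first column, and a solution of the system is
  determined by its first column.
\<close>

text \<open>At \<open>p = h = 0\<close> the truncated subtraction yields the value 1, as \<open>c\<^sup>0 = 1\<close> requires.\<close>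

definition ballot :: "nat \<Rightarrow> nat \<Rightarrow> int" where
  "ballot p h = int ((2 * h + p - 1) choose h)
     - (if h = 0 then 0 else int ((2 * h + p - 1) choose (h - 1)))"

lemma ballot_0_right [simp]: "ballot p 0 = 1"
  by (simp add: ballot_def)

lemma ballot_0_Suc [simp]: "ballot 0 (Suc h) = 0"
  using binomial_symmetric[of h "Suc (2 * h)"] by (simp add: ballot_def)

text \<open>Pascal's rule in both binomials; in terms of coefficients, c^(p+1) = c^p + t
  c^(p+2).\<close>

lemma ballot_Suc_Suc: "ballot (Suc p) (Suc h) = ballot p (Suc h) + ballot (Suc (Suc p)) h"
  by (cases h) (simp_all add: ballot_def)

text \<open>The first branch of the trapezoid applies exactly when \<open>h = 0\<close>. Otherwise
  \<open>k - m = h - 1\<close>, and symmetry turns the leading binomial into the one in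
  \<open>ballot\<close>.\<close>

lemma catalan_trapezoid_eq_ballot:
  "catalan_trapezoid (Suc p) h (h + p) = ballot (Suc p) h"
proof (cases h)
  case (Suc i)
  have "(2 * h + p) choose (h + p) = (2 * h + p) choose h"
    using binomial_symmetric[of h "2 * h + p"] by (simp add: mult_2)
  with Suc show ?thesis
    by (simp add: catalan_trapezoid_def ballot_def mult_2 add.assoc)
qed (simp add: catalan_trapezoid_def)

text \<open>The coefficient of t^d in c^p times the series with coefficients \<open>u 1\<close>,
  \<open>u 2\<close>, ...\<close>

definition ballot_conv :: "(nat \<Rightarrow> complex) \<Rightarrow> nat \<Rightarrow> nat \<Rightarrow> complex" where
  "ballot_conv u p d = (\<Sum>h=0..d. of_int (ballot p h) * u (d - h + 1))"

lemma ballot_conv_0_right: "ballot_conv u p 0 = u 1"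
  by (simp add: ballot_conv_def)

lemma ballot_conv_0_left: "ballot_conv u 0 d = u (d + 1)"
  by (cases d)
    (simp_all add: ballot_conv_def sum.atLeast0_atMost_Suc_shift del: sum.cl_ivl_Suc)

lemma ballot_conv_Suc_Suc:
  "ballot_conv u (Suc p) (Suc d) = ballot_conv u p (Suc d) + ballot_conv u (Suc (Suc p)) d"
  by (simp add: ballot_conv_def sum.atLeast0_atMost_Suc_shift ballot_Suc_Suc
      sum.distrib algebra_simps del: sum.cl_ivl_Suc)

text \<open>Iterating \<open>ballot_conv_Suc_Suc\<close> peels off the summand \<open>j = p\<close>
  and raises p while lowering d, so \<open>p + d\<close> stays fixed; at \<open>d = 0\<close> both
  sides are \<open>u 1\<close>.\<close>

lemma ballot_conv_eq_sum:
  "ballot_conv u (Suc p) d = (\<Sum>j=p..p + d. ballot_conv u j (p + d - j))"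
proof (induction d arbitrary: p)
  case 0
  show ?case by (simp add: ballot_conv_0_right)
next
  case (Suc d)
  show ?case
    using Suc.IH[of "Suc p"]
    by (simp add: ballot_conv_Suc_Suc sum.atLeast_Suc_atMost[of p] del: sum.cl_ivl_Suc)
qed

theorem theorem3p1:
  fixes x :: "nat \<Rightarrow> nat \<Rightarrow> complex"
  shows "catalan_triangle_system x \<longleftrightarrow>
    (\<forall>n\<ge>2. \<forall>m\<in>{2..n}.
       x n m = (\<Sum>h=0..n - m.
         of_int (catalan_trapezoid (m - 1) h (h + m - 2)) * x (n - m - h + 1) 1))"
    (is "_ \<longleftrightarrow> ?formula")
proof -
  \<comment> \<open>Column m belongs to the power c^(m-1), so column 1 of \<open>y\<close> is that
    of \<open>x\<close>.\<close>
  define y where "y n m = ballot_conv (\<lambda>i. x i 1) (m - 1) (n - m)" for n m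
  have y_system: "y (n + 1) (k + 1) = (\<Sum>j=k..n. y n j)" if "1 \<le> k" "k \<le> n" for n k
  proof -
    define q d where "q = k - 1" and "d = n - k"
    with that have k: "k = Suc q" and n: "n = Suc q + d" by simp_all
    have "(\<Sum>j=k..n. y n j) = (\<Sum>j=Suc q..Suc (q + d). y n j)"
      by (simp add: k n del: sum.cl_ivl_Suc)
    also have "\<dots> = (\<Sum>j=q..q + d. y n (Suc j))"
      by (rule sum.shift_bounds_cl_Suc_ivl)
    also have "\<dots> = (\<Sum>j=q..q + d. ballot_conv (\<lambda>i. x i 1) j (q + d - j))"
      by (simp add: y_def n)
    also have "\<dots> = y (n + 1) (k + 1)"
      by (simp add: y_def k n ballot_conv_eq_sum[symmetric])
    finally show ?thesis ..
  qed
  have y_col1: "y n 1 = x n 1" if "1 \<le> n" for n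
    using that by (simp add: y_def ballot_conv_0_left)
  have y_sum: "y n m = (\<Sum>h=0..n - m.
      of_int (catalan_trapezoid (m - 1) h (h + m - 2)) * x (n - m - h + 1) 1)"
    if "2 \<le> m" for n m
  proof -
    obtain p where "m = Suc (Suc p)"
      using le_Suc_ex[OF \<open>2 \<le> m\<close>] by auto
    then show ?thesis
      by (simp add: y_def ballot_conv_def catalan_trapezoid_eq_ballot)
  qed
  \<comment> \<open>The formula is silent on column 1, but there \<open>y_col1\<close> gives the
    equality for free.\<close>
  have formula_iff: "?formula \<longleftrightarrow> (\<forall>n m. 1 \<le> m \<and> m \<le> n \<longrightarrow> x n m = y n m)"
  proof
    assume f: ?formula
    show "\<forall>n m. 1 \<le> m \<and> m \<le> n \<longrightarrow> x n m = y n m"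
    proof (intro allI impI)
      fix n m :: nat
      assume mn: "1 \<le> m \<and> m \<le> n"
      show "x n m = y n m"
      proof (cases "m = 1")
        case True
        with mn y_col1 show ?thesis by simp
      next
        case False
        with mn have "2 \<le> m" "2 \<le> n" "m \<in> {2..n}" by auto
        with f have "x n m = (\<Sum>h=0..n - m.
            of_int (catalan_trapezoid (m - 1) h (h + m - 2)) * x (n - m - h + 1) 1)"
          by blast
        also have "\<dots> = y n m"
          by (rule y_sum[OF \<open>2 \<le> m\<close>, symmetric])
        finally show ?thesis .
      qed
    qed
  next
    assume eq: "\<forall>n m. 1 \<le> m \<and> m \<le> n \<longrightarrow> x n m = y n m"
    show ?formula
    proof (intro allI impI ballI)
      fix n m :: nat
      assume "m \<in> {2..n}"
      then have "2 \<le> m" "1 \<le> m \<and> m \<le> n" by auto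
      then have "x n m = y n m"
        using eq by blast
      also note y_sum[OF \<open>2 \<le> m\<close>]
      finally show "x n m = (\<Sum>h=0..n - m.
        of_int (catalan_trapezoid (m - 1) h (h + m - 2)) * x (n - m - h + 1) 1)" .
    qed
  qed
  show ?thesis
    unfolding formula_iff
  proof
    assume sys: "catalan_triangle_system x"
    have "x n m = y n m" if "1 \<le> m" "m \<le> n" for n m
      using that
    \<comment> \<open>Row \<open>n + 1\<close> is forced by row \<open>n\<close> except in column 1,
      which \<open>x\<close> and \<open>y\<close> share.\<close>
    proof (induction n arbitrary: m)
      case (Suc n)
      show ?case
      proof (cases "m = 1")
        case True
        then show ?thesis using y_col1 by simp
      next
        case False
        with Suc.prems obtain k where k: "m = k + 1" "1 \<le> k" "k \<le> n"
          by (cases m) auto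
        have "x (n + 1) (k + 1) = (\<Sum>j=k..n. x n j)"
          using sys k by (simp add: catalan_triangle_system_def)
        also have "\<dots> = (\<Sum>j=k..n. y n j)"
          using Suc.IH k by (intro sum.cong) auto
        also have "\<dots> = y (n + 1) (k + 1)"
          by (rule y_system[OF k(2,3), symmetric])
        finally show ?thesis using k by simp
      qed
    qed simp
    then show "\<forall>n m. 1 \<le> m \<and> m \<le> n \<longrightarrow> x n m = y n m" by blast
  next
    assume eq: "\<forall>n m. 1 \<le> m \<and> m \<le> n \<longrightarrow> x n m = y n m"
    show "catalan_triangle_system x"
      unfolding catalan_triangle_system_def
    proof (intro allI impI ballI)
      fix n k :: nat
      assume "k \<in> {1..n}"
      then have k: "1 \<le> k" "k \<le> n" by auto
      \<comment> \<open>All entries involved lie in the triangle, so \<open>y_system\<close>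
        transfers to \<open>x\<close>.\<close>
      have "(\<Sum>j=k..n. x n j) = (\<Sum>j=k..n. y n j)"
        using eq k by (intro sum.cong) auto
      also have "\<dots> = y (n + 1) (k + 1)"
        by (rule y_system[OF k, symmetric])
      also have "\<dots> = x (n + 1) (k + 1)"
        using eq k by simp
      finally show "x (n + 1) (k + 1) = (\<Sum>j=k..n. x n j)" ..
    qed
  qed
qed

end
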